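(* Let $H=\operatorname{GP}(\sigma,\gamma,\pi,\ell)=\operatorname{GP}_S(\sigma,\gamma,\mathcal L(S))$ be a $d$-variate generalized Pareto distribution with spectral random vector $S$, and let $j\in\{1,\dots,d\}$. If $(\sigma_j,\gamma_j)=(1,0)$, then the $j$-th marginal distribution function $H_j$ of $H$ is given, for $z_j\in\mathbb R$, by $$H_j(z_j)=\ell\bigl(\pi_1,\dots,\pi_{j-1},\pi_je^{-(z_j\wedge 0)},\pi_{j+1},\dots,\pi_d\bigr)-\pi_je^{-z_j}$$ $$=\mathbb E\bigl[\max\{e^{S_1},\dots,e^{S_{j-1}},e^{S_j-(z_j\wedge 0)},e^{S_{j+1}},\dots,e^{S_d}\}\bigr]-e^{-z_j}\,\mathbb E[e^{S_j}].$$ Moreover: (i) If $z_j\ge 0$, the right-hand sides simplify to $1-\pi_je^{-z_j}=1-e^{-z_j}\mathbb E[e^{S_j}]$. (ii) If $H=\operatorname{GP}_T(\sigma,\gamma,\mathcal L(T))$, then $$H_j(z_j)=\mathbb E\bigl[\max\{e^{T_1-\max(T)},\dots,e^{T_{j-1}-\max(T)},e^{T_j-\max(T)-(z_j\wedge 0)},e^{T_{j+1}-\max(T)},\dots,e^{T_d-\max(T)}\}\bigr]-e^{-z_j}\,\mathbb E[e^{T_j-\max(T)}],$$ which for $z_j\ge 0$ simplifies to $1-e^{-z_j}\,\mathbb E[e^{T_j-\max(T)}]$. (iii) If $H=\operatorname{GP}_U(\sigma,\gamma,\mathcal L(U))$, then $$H_j(z_j)=\frac{\mathbb E\bigl[\max\{e^{U_1},\dots,e^{U_{j-1}},e^{U_j-(z_j\wedge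 0)},e^{U_{j+1}},\dots,e^{U_d}\}\bigr]-e^{-z_j}\,\mathbb E[e^{U_j}]}{\mathbb E[e^{\max(U)}]}.$$ (iv) For general $(\sigma_j,\gamma_j)\in(0,\infty)\times\mathbb R$ and real $x_j$ such that $\sigma_j+\gamma_jx_j>0$, put $z_j=\gamma_j^{-1}\log(1+\gamma_jx_j/\sigma_j)$, so that $e^{-z_j}=(1+\gamma_jx_j/\sigma_j)^{-1/\gamma_j}$. Then $$H_j(x_j)=\ell\bigl(\pi_1,\dots,\pi_{j-1},\pi_je^{-(z_j\wedge 0)},\pi_{j+1},\dots,\pi_d\bigr)-\pi_je^{-z_j}$$ $$=\mathbb E\bigl[\max\{e^{S_1},\dots,e^{S_{j-1}},e^{S_j-(z_j\wedge 0)},e^{S_{j+1}},\dots,e^{S_d}\}\bigr]-e^{-z_j}\,\mathbb E[e^{S_j}],$$ and both right-hand sides simplify to $1-\pi_je^{-z_j}=1-e^{-z_j}\mathbb E[e^{S_j}]$ if $x_j\ge 0$. If $H=\operatorname{GP}_T(\sigma,\gamma,\mathcal L(T))$, then, with the same $z_j$, $$H_j(x_j)=\mathbb E\bigl[\max\{e^{T_1-\max(T)},\dots,e^{T_{j-1}-\max(T)},e^{T_j-\max(T)-(z_j\wedge 0)},e^{T_{j+1}-\max(T)},\dots,e^{T_d-\max(T)}\}\bigr]-e^{-z_j}\,\mathbb E[e^{T_j-\max(T)}],$$ which for $x_j\ge 0$ simplifies to $1-e^{-z_j}\,\mathbb E[e^{T_j-\max(T)}]$. If $H=\operatorname{GP}_U(\sigma,\gamma,\mathcal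 L(U))$, then, with the same $z_j$, $$H_j(x_j)=\frac{\mathbb E\bigl[\max\{e^{U_1},\dots,e^{U_{j-1}},e^{U_j-(z_j\wedge 0)},e^{U_{j+1}},\dots,e^{U_d}\}\bigr]-e^{-z_j}\,\mathbb E[e^{U_j}]}{\mathbb E[e^{\max(U)}]}.$$
   Context: Conventions: operations and order relations between vectors are componentwise; $a\wedge b=\min(a,b)$; $\max(x)=\max(x_1,\dots,x_d)$; $e^{-\infty}=0$; $\mathcal L(\xi)$ is the law of $\xi$. If $\gamma=0$, $(1+\gamma x)^{-1/\gamma}$ is read as $e^{-x}$ and $\gamma^{-1}\log(1+\gamma x)$ as $x$. A function $\ell:[0,\infty)^d\to[0,\infty)$ is a stable tail dependence function (stdf) if there is a random vector $V$ with values in $[0,\infty)^d$ and $\mathbb E[V_j]=1$ for all $j$ such that $\ell(y)=\mathbb E[\max_{j}(y_jV_j)]$ for all $y\in[0,\infty)^d$. For $\sigma\in(0,\infty)^d$, $\gamma\in\mathbb R^d$, $\pi\in(0,1]^d$ and a stdf $\ell$ with $\ell(\pi)=1$, put $\eta_j=-\sigma_j/\gamma_j$ if $\gamma_j>0$ and $\eta_j=-\infty$ if $\gamma_j\le 0$. $\operatorname{GP}(\sigma,\gamma,\pi,\ell)$ is the probability distribution concentrated on $\{x\in[-\infty,\infty)^d:x\ge\eta,\ x_j>0\text{ for some }j\}$ whose cdf $H$ satisfies $H(x)=\ell\{\pi(1+\gamma\tfrac{x\wedge 0}{\sigma})^{-1/\gamma}\}-\ell\{\pi(1+\gamma\tfrac{x}{\sigma})^{-1/\gamma}\}$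 for all $x\in\mathbb R^d$ with $\sigma_j+\gamma_jx_j>0$ for all $j$. A spectral random vector is a random vector $S$ with values in $[-\infty,0]^d$, $\Pr[\max(S)=0]=1$ and $\Pr[S_j>-\infty]>0$ for all $j$. $\operatorname{GP}_S(\sigma,\gamma,\mathcal L(S))$ denotes $\operatorname{GP}(\sigma,\gamma,\pi,\ell)$ with $\pi_j=\mathbb E[e^{S_j}]$ and $\ell(y)=\mathbb E[\max_j(y_je^{S_j}/\pi_j)]$; every $(\pi,\ell)$ with $\ell(\pi)=1$ arises from an $S$ that is unique in law. For a random vector $T$ in $[-\infty,\infty)^d$ with $\Pr[T_j>-\infty]>0$ for all $j$ and $\Pr[\max(T)>-\infty]=1$, $\operatorname{GP}_T(\sigma,\gamma,\mathcal L(T))=\operatorname{GP}_S(\sigma,\gamma,\mathcal L(S))$ with $S=T-\max(T)$. For a random vector $U$ in $[-\infty,\infty)^d$ with $0<\mathbb E[e^{U_j}]<\infty$ for all $j$, $\operatorname{GP}_U(\sigma,\gamma,\mathcal L(U))=\operatorname{GP}(\sigma,\gamma,\pi,\ell)$ with $\pi_j=\mathbb E[e^{U_j}]/\mathbb E[e^{\max(U)}]$ and $\ell(y)=\mathbb E[\max_j\{y_je^{U_j}/\mathbb E[e^{U_j}]\}]$. *)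

theory Defs
  imports "HOL-Probability.Probability"
begin

text \<open>
  Coordinates are indexed by a finite type \<open>'d\<close> (nonempty, as every type), so \<open>d = CARD('d)\<close> and
  vectors are functions on \<open>'d\<close>, with the library's pointwise order. The Borel sets on
  \<open>'d \<Rightarrow> ereal\<close> and \<open>'d \<Rightarrow> real\<close> are those of the product topology.
  Laws are Borel probability measures; a support condition on a random vector is imposed on its law,
  that is, almost surely.
\<close>

text \<open>The value at \<open>\<infinity>\<close> is junk: arguments lie in \<open>[-\<infinity>,\<infinity>)\<close>, almost surely.\<close>

definition eexp :: "ereal \<Rightarrow> real" where
  "eexp x = (if x = -\<infinity> then 0 else exp (real_of_ereal x))"

text \<open>
  \<open>(1 + \<gamma> u) powr (-1/\<gamma>)\<close> and \<open>log (1 + \<gamma> u) / \<gamma>\<close>, with their limits at \<open>\<gamma> = 0\<close>;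
  used only where \<open>1 + \<gamma> u > 0\<close>.
\<close>

definition gp_pow :: "real \<Rightarrow> real \<Rightarrow> real" where
  "gp_pow \<gamma> u = (if \<gamma> = 0 then exp (- u) else (1 + \<gamma> * u) powr (- 1 / \<gamma>))"

definition gp_log :: "real \<Rightarrow> real \<Rightarrow> real" where
  "gp_log \<gamma> u = (if \<gamma> = 0 then u else ln (1 + \<gamma> * u) / \<gamma>)"

text \<open>
  The random vector \<open>V\<close> of the definition enters through its law \<open>Q\<close>. Only the values of \<open>l\<close> on
  the nonnegative orthant are constrained or ever used.
\<close>

definition is_stdf :: "(('d::finite \<Rightarrow> real) \<Rightarrow> real) \<Rightarrow> bool" where
  "is_stdf l \<longleftrightarrow>
     (\<exists>Q :: ('d \<Rightarrow> real) measure.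
        prob_space Q \<and> sets Q = sets borel \<and>
        (AE v in Q. \<forall>j. 0 \<le> v j) \<and>
        (\<forall>j. integrable Q (\<lambda>v. v j) \<and> (\<integral>v. v j \<partial>Q) = 1) \<and>
        (\<forall>y. (\<forall>j. 0 \<le> y j) \<longrightarrow> l y = (\<integral>v. Max (range (\<lambda>j. y j * v j)) \<partial>Q)))"

definition gp_lower :: "('d::finite \<Rightarrow> real) \<Rightarrow> ('d \<Rightarrow> real) \<Rightarrow> 'd \<Rightarrow> ereal" where
  "gp_lower \<sigma> \<gamma> j = (if \<gamma> j > 0 then ereal (- \<sigma> j / \<gamma> j) else -\<infinity>)"

definition joint_cdf :: "('d::finite \<Rightarrow> ereal) measure \<Rightarrow> ('d \<Rightarrow> real) \<Rightarrow> real" where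
  "joint_cdf H x = measure H {y. \<forall>j. y j \<le> ereal (x j)}"

definition marginal_cdf :: "('d::finite \<Rightarrow> ereal) measure \<Rightarrow> 'd \<Rightarrow> real \<Rightarrow> real" where
  "marginal_cdf H j z = measure (distr H borel (\<lambda>y. y j)) {..ereal z}"

text \<open>\<open>is_GP \<sigma> \<gamma> \<pi> l H\<close> reads \<open>H = GP(\<sigma>, \<gamma>, \<pi>, l)\<close>; likewise for the three variants below.\<close>

definition is_GP ::
  "('d::finite \<Rightarrow> real) \<Rightarrow> ('d \<Rightarrow> real) \<Rightarrow> ('d \<Rightarrow> real) \<Rightarrow> (('d \<Rightarrow> real) \<Rightarrow> real) \<Rightarrow>
   ('d \<Rightarrow> ereal) measure \<Rightarrow> bool" where
  "is_GP \<sigma> \<gamma> \<pi> l H \<longleftrightarrow>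
     (\<forall>j. 0 < \<sigma> j) \<and> (\<forall>j. 0 < \<pi> j \<and> \<pi> j \<le> 1) \<and> is_stdf l \<and> l \<pi> = 1 \<and>
     prob_space H \<and> sets H = sets borel \<and>
     (AE x in H. (\<forall>j. x j < \<infinity>) \<and> gp_lower \<sigma> \<gamma> \<le> x \<and> (\<exists>j. 0 < x j)) \<and>
     (\<forall>x. (\<forall>j. 0 < \<sigma> j + \<gamma> j * x j) \<longrightarrow>
        joint_cdf H x = l (\<lambda>j. \<pi> j * gp_pow (\<gamma> j) (min (x j) 0 / \<sigma> j))
                        - l (\<lambda>j. \<pi> j * gp_pow (\<gamma> j) (x j / \<sigma> j)))"

definition is_spectral_law :: "('d::finite \<Rightarrow> ereal) measure \<Rightarrow> bool" where
  "is_spectral_law Q \<longleftrightarrow>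
     prob_space Q \<and> sets Q = sets borel \<and>
     (AE s in Q. \<forall>j. s j \<le> 0) \<and>
     measure Q {s. Max (range s) = 0} = 1 \<and>
     (\<forall>j. measure Q {s. s j > -\<infinity>} > 0)"

definition is_GP_S ::
  "('d::finite \<Rightarrow> real) \<Rightarrow> ('d \<Rightarrow> real) \<Rightarrow> ('d \<Rightarrow> ereal) measure \<Rightarrow>
   ('d \<Rightarrow> ereal) measure \<Rightarrow> bool" where
  "is_GP_S \<sigma> \<gamma> Q H \<longleftrightarrow>
     is_spectral_law Q \<and>
     is_GP \<sigma> \<gamma> (\<lambda>j. \<integral>s. eexp (s j) \<partial>Q)
       (\<lambda>y. \<integral>s. Max (range (\<lambda>j. y j * eexp (s j) / (\<integral>s'. eexp (s' j) \<partial>Q))) \<partial>Q) H"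

text \<open>Where \<open>max t = -\<infinity>\<close>, an event of probability zero, \<open>t j - max t\<close> takes the junk value \<open>\<infinity>\<close>.\<close>

definition is_GP_T ::
  "('d::finite \<Rightarrow> real) \<Rightarrow> ('d \<Rightarrow> real) \<Rightarrow> ('d \<Rightarrow> ereal) measure \<Rightarrow>
   ('d \<Rightarrow> ereal) measure \<Rightarrow> bool" where
  "is_GP_T \<sigma> \<gamma> Q H \<longleftrightarrow>
     prob_space Q \<and> sets Q = sets borel \<and>
     (AE t in Q. \<forall>j. t j < \<infinity>) \<and>
     (\<forall>j. measure Q {t. t j > -\<infinity>} > 0) \<and>
     measure Q {t. Max (range t) > -\<infinity>} = 1 \<and>
     is_GP_S \<sigma> \<gamma> (distr Q borel (\<lambda>t j. t j - Max (range t))) H"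

definition is_GP_U ::
  "('d::finite \<Rightarrow> real) \<Rightarrow> ('d \<Rightarrow> real) \<Rightarrow> ('d \<Rightarrow> ereal) measure \<Rightarrow>
   ('d \<Rightarrow> ereal) measure \<Rightarrow> bool" where
  "is_GP_U \<sigma> \<gamma> Q H \<longleftrightarrow>
     prob_space Q \<and> sets Q = sets borel \<and>
     (AE u in Q. \<forall>j. u j < \<infinity>) \<and>
     (\<forall>j. integrable Q (\<lambda>u. eexp (u j)) \<and> 0 < (\<integral>u. eexp (u j) \<partial>Q)) \<and>
     is_GP \<sigma> \<gamma> (\<lambda>j. (\<integral>u. eexp (u j) \<partial>Q) / (\<integral>u. eexp (Max (range u)) \<partial>Q))
       (\<lambda>y. \<integral>u. Max (range (\<lambda>j. y j * eexp (u j) / (\<integral>u'. eexp (u' j) \<partial>Q))) \<partial>Q) H"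

text \<open>The maximum of \<open>exp (s i)\<close> over all \<open>i\<close>, with the \<open>j\<close>-th entry replaced by \<open>exp (s j - w)\<close>.\<close>

definition max_exp_shift :: "('d::finite \<Rightarrow> ereal) \<Rightarrow> 'd \<Rightarrow> real \<Rightarrow> real" where
  "max_exp_shift s j w = Max (range (\<lambda>i. if i = j then eexp (s j - ereal w) else eexp (s i)))"

end

theory Submission
  imports Defs "HOL-Real_Asymp.Real_Asymp"
begin

text \<open>
  The marginal distribution function at \<open>x\<close> is the limit of the joint one along points whose other
  coordinates increase to the upper endpoints of the margins; the mass that is missed is at most
  one minus the joint distribution function at points whose coordinates all increase to their
  endpoints, and this vanishes because \<open>y j \<le> l y \<le> (\<Sum>i. y i)\<close>. The same representation
  applied to the parameters of each of the three stochastic representations of \<open>H\<close> gives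
  the formulas in \<open>S\<close>, \<open>T\<close> and \<open>U\<close>.
\<close>

section \<open>Maxima of exponentials of coordinates\<close>

lemma Max_range_mult_left:
  fixes f :: "'d::finite \<Rightarrow> real"
  assumes "0 \<le> c"
  shows "Max (range (\<lambda>i. c * f i)) = c * Max (range f)"
proof -
  have "mono ((*) c)"
    using assms by (simp add: mono_def mult_left_mono)
  from mono_Max_commute[OF this, of "range f"] show ?thesis
    by (simp add: image_image)
qed

text \<open>At \<open>-\<infinity>\<close> both sides are 0. The value \<open>\<infinity>\<close> is
  excluded: there both occurrences of \<open>eexp\<close> equal 1 and the factor
  \<open>exp (- w)\<close> would be lost.\<close>

lemma eexp_minus_ereal:
  assumes "x < \<infinity>"
  shows "eexp (x - ereal w) = exp (- w) * eexp x"
  using assms by (cases x) (auto simp: eexp_def exp_diff exp_minus field_simps)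

lemma borel_measurable_eexp [measurable]: "eexp \<in> borel_measurable borel"
  unfolding eexp_def[abs_def] by measurable

text \<open>Turns the shift of one exponent into a weight on one coordinate, the form in which the
  arguments of \<open>l\<close> enter its integral representation.\<close>

lemma max_exp_shift_eq:
  assumes "s j < \<infinity>"
  shows "max_exp_shift s j w = Max (range (\<lambda>i. (if i = j then exp (- w) else 1) * eexp (s i)))"
  unfolding max_exp_shift_def
  by (rule arg_cong[where f = Max], rule image_cong) (auto simp: eexp_minus_ereal[OF assms])

lemma borel_measurable_max_exp_shift [measurable (raw)]:
  assumes "X \<in> borel_measurable M"
  shows "(\<lambda>\<omega>. max_exp_shift (X \<omega>) j w) \<in> borel_measurable M"
proof -
  have [measurable]: "(\<lambda>\<omega>. X \<omega> i) \<in> borel_measurable M" for i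
    by (rule measurable_product_then_coordinatewise[OF assms])
  show ?thesis unfolding max_exp_shift_def by measurable
qed

section \<open>Bounds for stable tail dependence functions\<close>

text \<open>For nonnegative \<open>v\<close> the maximum of the \<open>y i * v i\<close> lies
  between any single term and the sum of all terms; integrate and use that every \<open>v i\<close>
  has mean 1.\<close>

lemma stdf_bounds:
  assumes "is_stdf l" and y: "\<And>i. 0 \<le> y i"
  shows "y j \<le> l y" and "l y \<le> (\<Sum>i\<in>UNIV. y i)"
proof -
  obtain Q :: "('a \<Rightarrow> real) measure" where Q: "sets Q = sets borel" "AE v in Q. \<forall>j. 0 \<le> v j"
      "\<And>j. integrable Q (\<lambda>v. v j)" "\<And>j. (\<integral>v. v j \<partial>Q) = 1"
      "l y = (\<integral>v. Max (range (\<lambda>j. y j * v j)) \<partial>Q)"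
    using assms unfolding is_stdf_def by blast
  have [measurable_cong]: "sets Q = sets borel" by fact
  have sum_int: "integrable Q (\<lambda>v. \<Sum>i\<in>UNIV. y i * v i)"
    by (intro Bochner_Integration.integrable_sum integrable_mult_right Q)
  have le: "AE v in Q. y k * v k \<le> Max (range (\<lambda>j. y j * v j))" for k
    by (intro always_eventually allI Max_ge) auto
  have ub: "AE v in Q. Max (range (\<lambda>j. y j * v j)) \<le> (\<Sum>i\<in>UNIV. y i * v i)"
    using Q(2)
  proof eventually_elim
    case (elim v)
    then show ?case using y by (auto intro!: member_le_sum)
  qed
  \<comment> \<open>Monotonicity of the integral is available only for integrable functions, so the
    maximum is first dominated by the sum.\<close>
  have max_int: "integrable Q (\<lambda>v. Max (range (\<lambda>j. y j * v j)))"
  proof (rule Bochner_Integration.integrable_bound[OF sum_int])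
    show "AE v in Q. norm (Max (range (\<lambda>j. y j * v j))) \<le> norm (\<Sum>i\<in>UNIV. y i * v i)"
      using Q(2) ub le[of j]
    proof eventually_elim
      case (elim v)
      then have "0 \<le> y j * v j" using y by simp
      then have "0 \<le> Max (range (\<lambda>j. y j * v j))" using elim(3) by (rule order_trans)
      then show ?case using elim(2) unfolding real_norm_def by linarith
    qed
  qed measurable
  have "(\<integral>v. y j * v j \<partial>Q) \<le> l y"
    unfolding Q(5) by (intro integral_mono_AE max_int integrable_mult_right Q le)
  then show "y j \<le> l y" using Q(4)[of j] by simp
  have "l y \<le> (\<integral>v. (\<Sum>i\<in>UNIV. y i * v i) \<partial>Q)"
    unfolding Q(5) by (intro integral_mono_AE max_int sum_int ub)
  also have "\<dots> = (\<Sum>i\<in>UNIV. y i)"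
    using Q(3,4) by (subst Bochner_Integration.integral_sum) auto
  finally show "l y \<le> (\<Sum>i\<in>UNIV. y i)" .
qed

section \<open>The marginal transformation and its behaviour at the upper endpoint\<close>

lemma gp_pow_pos:
  assumes "0 < 1 + \<gamma> * u"
  shows "0 < gp_pow \<gamma> u"
  using assms by (simp add: gp_pow_def)

lemma gp_pow_0 [simp]: "gp_pow \<gamma> 0 = 1"
  by (simp add: gp_pow_def)

lemma gp_log_0 [simp]: "gp_log \<gamma> 0 = 0"
  by (simp add: gp_log_def)

lemma exp_minus_gp_log:
  assumes "0 < 1 + \<gamma> * u"
  shows "exp (- gp_log \<gamma> u) = gp_pow \<gamma> u"
  using assms by (auto simp: gp_pow_def gp_log_def powr_def)

lemma gp_log_nonneg:
  assumes "0 \<le> u" "0 < 1 + \<gamma> * u"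
  shows "0 \<le> gp_log \<gamma> u"
proof (cases "\<gamma>" "0 :: real" rule: linorder_cases)
  case less
  then have "\<gamma> * u \<le> 0" using assms by (simp add: mult_nonpos_nonneg)
  then show ?thesis using assms less by (auto simp: gp_log_def divide_nonpos_neg)
qed (use assms in \<open>auto simp: gp_log_def\<close>)

lemma gp_log_nonpos:
  assumes "u \<le> 0" "0 < 1 + \<gamma> * u"
  shows "gp_log \<gamma> u \<le> 0"
proof (cases "\<gamma>" "0 :: real" rule: linorder_cases)
  case less
  then have "0 \<le> \<gamma> * u" using assms by (simp add: mult_nonpos_nonpos)
  then show ?thesis using assms less by (auto simp: gp_log_def divide_nonneg_neg)
next
  case greater
  then have "\<gamma> * u \<le> 0" using assms by (simp add: mult_nonneg_nonpos)
  then show ?thesis using assms greater by (auto simp: gp_log_def divide_nonpos_pos)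
qed (use assms in \<open>auto simp: gp_log_def\<close>)

text \<open>The logarithmic transform has the sign of its argument for every
  \<open>\<gamma>\<close>, so truncating at 0 before or after transforming is the same; for
  \<open>0 \<le> x\<close> both sides are 1.\<close>

lemma exp_minus_min_gp_log:
  assumes "0 < \<sigma>" "0 < \<sigma> + \<gamma> * x"
  shows "exp (- min (gp_log \<gamma> (x / \<sigma>)) 0) = gp_pow \<gamma> (min x 0 / \<sigma>)"
proof -
  have pos: "0 < 1 + \<gamma> * (x / \<sigma>)" using assms by (simp add: field_simps)
  show ?thesis
  proof (cases "0 \<le> x")
    case True
    then show ?thesis using gp_log_nonneg[OF _ pos] assms by (simp add: min_def)
  next
    case False
    then have "gp_log \<gamma> (x / \<sigma>) \<le> 0"
      using gp_log_nonpos[OF _ pos] assms by (simp add: divide_nonpos_pos)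
    then show ?thesis using False exp_minus_gp_log[OF pos] by (simp add: min_def)
  qed
qed

text \<open>Increases to the upper endpoint of the margin, staying in the domain \<open>\<sigma> + \<gamma> x > 0\<close>.\<close>

definition gp_approach :: "real \<Rightarrow> real \<Rightarrow> nat \<Rightarrow> real" where
  "gp_approach \<sigma> \<gamma> n = (if 0 \<le> \<gamma> then real n else - (\<sigma> / \<gamma>) * (1 - 1 / real (Suc n)))"

text \<open>Nonnegative points are unaffected in the first term of the joint distribution function,
  where coordinates are truncated at 0.\<close>

lemma gp_approach_nonneg:
  assumes "0 < \<sigma>"
  shows "0 \<le> gp_approach \<sigma> \<gamma> n"
proof (cases "0 \<le> \<gamma>")
  case False
  then have "0 \<le> - (\<sigma> / \<gamma>)" using assms by (simp add: divide_nonneg_neg)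
  then have "0 \<le> - (\<sigma> / \<gamma>) * (1 - 1 / real (Suc n))"
    by (rule mult_nonneg_nonneg) simp
  then show ?thesis using False by (simp add: gp_approach_def)
qed (simp add: gp_approach_def)

text \<open>For negative \<open>\<gamma>\<close> the endpoint \<open>- \<sigma> / \<gamma>\<close>
  is outside the domain; the factor \<open>1 - 1 / real (Suc n)\<close> leaves exactly
  \<open>\<sigma> / real (Suc n)\<close>.\<close>

lemma gp_approach_domain:
  assumes "0 < \<sigma>"
  shows "0 < \<sigma> + \<gamma> * gp_approach \<sigma> \<gamma> n"
proof (cases "0 \<le> \<gamma>")
  case True
  then have "0 \<le> \<gamma> * real n" by simp
  then have "0 < \<sigma> + \<gamma> * real n" using assms by linarith
  then show ?thesis using True by (simp add: gp_approach_def)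
next
  case False
  then have "\<sigma> + \<gamma> * gp_approach \<sigma> \<gamma> n = \<sigma> / real (Suc n)"
    by (simp del: of_nat_Suc add: gp_approach_def right_diff_distrib)
  then show ?thesis using assms by simp
qed

text \<open>Three regimes: for negative \<open>\<gamma>\<close> the base tends to 0 under a positive
  exponent, for \<open>\<gamma> = 0\<close> the decay is exponential, and for positive
  \<open>\<gamma>\<close> the base tends to infinity under a negative exponent.\<close>

lemma gp_pow_gp_approach:
  assumes "0 < \<sigma>"
  shows "(\<lambda>n. gp_pow \<gamma> (gp_approach \<sigma> \<gamma> n / \<sigma>)) \<longlonglongrightarrow> 0"
proof (cases "\<gamma>" "0 :: real" rule: linorder_cases)
  case less
  have "gp_pow \<gamma> (gp_approach \<sigma> \<gamma> n / \<sigma>) = (1 / real (Suc n)) powr (- 1 / \<gamma>)" for n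
  proof -
    have "1 + \<gamma> * (gp_approach \<sigma> \<gamma> n / \<sigma>) = 1 / real (Suc n)"
      using less assms by (simp add: gp_approach_def)
    then show ?thesis using less by (simp add: gp_pow_def)
  qed
  moreover have "(\<lambda>n. (1 / real (Suc n)) powr (- 1 / \<gamma>)) \<longlonglongrightarrow> 0"
  proof -
    have "0 < - 1 / \<gamma>" using less by (simp add: divide_neg_neg)
    then show ?thesis by real_asymp
  qed
  ultimately show ?thesis by simp
next
  case equal
  have "(\<lambda>n. exp (- (real n / \<sigma>))) \<longlonglongrightarrow> 0" using assms by real_asymp
  then show ?thesis using equal by (simp add: gp_pow_def gp_approach_def)
next
  case greater
  have "(\<lambda>n. (1 + \<gamma> * (real n / \<sigma>)) powr (- 1 / \<gamma>)) \<longlonglongrightarrow> 0"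
  proof (rule tendsto_neg_powr)
    show "- 1 / \<gamma> < 0" using greater by simp
    show "filterlim (\<lambda>n. 1 + \<gamma> * (real n / \<sigma>)) at_top sequentially"
      using assms greater by real_asymp
  qed
  then show ?thesis using greater by (simp add: gp_pow_def gp_approach_def)
qed

section \<open>The margin in terms of \<open>\<pi>\<close> and \<open>l\<close>\<close>

text \<open>The joint formula holds only at real points strictly inside the domain, so the other
  coordinates cannot simply be dropped; they have to be removed by a limit.\<close>

lemma GP_marginal:
  fixes H :: "('d::finite \<Rightarrow> ereal) measure"
  assumes GP: "is_GP \<sigma> \<gamma> \<pi> l H" and x: "0 < \<sigma> j + \<gamma> j * x" and z: "z = gp_log (\<gamma> j) (x / \<sigma> j)"
  shows "marginal_cdf H j x = l (\<pi>(j := \<pi> j * exp (- min z 0))) - \<pi> j * exp (- z)"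
proof -
  have \<sigma>: "0 < \<sigma> i" and \<pi>: "0 < \<pi> i" for i
    using GP by (auto simp: is_GP_def)
  have l: "is_stdf l" and l\<pi>: "l \<pi> = 1" and "prob_space H" and [measurable_cong]: "sets H = sets borel"
    and cdf: "\<And>x. (\<And>j. 0 < \<sigma> j + \<gamma> j * x j) \<Longrightarrow>
        joint_cdf H x = l (\<lambda>j. \<pi> j * gp_pow (\<gamma> j) (min (x j) 0 / \<sigma> j))
                        - l (\<lambda>j. \<pi> j * gp_pow (\<gamma> j) (x j / \<sigma> j))"
    using GP by (auto simp: is_GP_def)
  interpret prob_space H by fact
  have space: "space H = UNIV"
    using sets_eq_imp_space_eq[OF \<open>sets H = sets borel\<close>] by simp
  define b where "b n i = gp_approach (\<sigma> i) (\<gamma> i) n" for n i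
  define p where "p n i = \<pi> i * gp_pow (\<gamma> i) (b n i / \<sigma> i)" for n i
  have b_nonneg: "0 \<le> b n i" and b_dom: "0 < \<sigma> i + \<gamma> i * b n i" for n i
    using gp_approach_nonneg[OF \<sigma>] gp_approach_domain[OF \<sigma>] by (simp_all add: b_def)
  have dom: "0 < 1 + \<gamma> i * (u / \<sigma> i)" if "0 < \<sigma> i + \<gamma> i * u" for i u
    using that \<sigma>[of i] by (simp add: field_simps)
  have p_nonneg: "0 \<le> p n i" for n i
    using \<pi>[of i] gp_pow_pos[OF dom[OF b_dom]] by (simp add: p_def less_imp_le)
  have p_lim: "(\<lambda>n. p n i) \<longlonglongrightarrow> 0" for i
    unfolding p_def b_def using tendsto_mult_right_zero[OF gp_pow_gp_approach[OF \<sigma>]] .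
  \<comment> \<open>All coordinates of \<open>b n\<close> are nonnegative, so the first term is
    \<open>l \<pi> = 1\<close>.\<close>
  have cdf_b: "joint_cdf H (b n) = 1 - l (p n)" for n
    using cdf[of "b n", OF b_dom] l\<pi> b_nonneg by (simp add: min_absorb2 p_def[abs_def])
  have "(\<lambda>n. l (p n)) \<longlonglongrightarrow> 0"
  proof (rule tendsto_sandwich[OF _ _ tendsto_const])
    have "0 \<le> l (p n)" for n
      using p_nonneg[of n j] stdf_bounds(1)[of l "p n" j, OF l p_nonneg] by linarith
    then show "\<forall>\<^sub>F n in sequentially. 0 \<le> l (p n)" by simp
    show "\<forall>\<^sub>F n in sequentially. l (p n) \<le> (\<Sum>i\<in>UNIV. p n i)"
      by (intro always_eventually allI stdf_bounds(2) l p_nonneg)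
    show "(\<lambda>n. \<Sum>i\<in>UNIV. p n i) \<longlonglongrightarrow> 0"
      using tendsto_sum[of UNIV "\<lambda>i n. p n i" "\<lambda>_. 0"] p_lim by simp
  qed
  then have gap: "(\<lambda>n. 1 - joint_cdf H (b n)) \<longlonglongrightarrow> 0" by (simp add: cdf_b)

  define q where "q = \<pi> j * exp (- z)"
  have q_eq: "q = \<pi> j * gp_pow (\<gamma> j) (x / \<sigma> j)"
    using exp_minus_gp_log[OF dom[OF x]] by (simp add: q_def z)
  have q_nonneg: "0 \<le> q" using \<pi>[of j] by (simp add: q_def less_imp_le)
  \<comment> \<open>The first term of the joint distribution function at
    \<open>(b n)(j := x)\<close>. It does not depend on \<open>n\<close>, since truncation at 0
    sends every other coordinate to 0, where \<open>gp_pow\<close> is 1.\<close>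
  define c where "c = l (\<pi>(j := \<pi> j * exp (- min z 0)))"
  have cdf_c: "joint_cdf H ((b n)(j := x)) = c - l ((p n)(j := q))" for n
  proof -
    have "0 < \<sigma> i + \<gamma> i * ((b n)(j := x)) i" for i
      using x b_dom by simp
    from cdf[OF this]
    have "joint_cdf H ((b n)(j := x)) =
        l (\<lambda>i. \<pi> i * gp_pow (\<gamma> i) (min (((b n)(j := x)) i) 0 / \<sigma> i))
        - l (\<lambda>i. \<pi> i * gp_pow (\<gamma> i) (((b n)(j := x)) i / \<sigma> i))" .
    also have "(\<lambda>i. \<pi> i * gp_pow (\<gamma> i) (min (((b n)(j := x)) i) 0 / \<sigma> i))
        = \<pi>(j := \<pi> j * exp (- min z 0))"
      using exp_minus_min_gp_log[OF \<sigma> x] b_nonneg by (auto simp: fun_eq_iff z min_absorb2)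
    also have "(\<lambda>i. \<pi> i * gp_pow (\<gamma> i) (((b n)(j := x)) i / \<sigma> i)) = (p n)(j := q)"
      by (auto simp: fun_eq_iff p_def q_eq)
    finally show ?thesis by (simp add: c_def fun_upd_def)
  qed
  \<comment> \<open>Squeezed between its \<open>j\<close>-th argument \<open>q\<close> and the sum
    of its arguments, in which all terms but \<open>q\<close> vanish in the limit.\<close>
  have "(\<lambda>n. l ((p n)(j := q))) \<longlonglongrightarrow> q"
  proof (rule tendsto_sandwich[OF _ _ tendsto_const])
    have nn: "0 \<le> ((p n)(j := q)) i" for n i using p_nonneg q_nonneg by simp
    show "\<forall>\<^sub>F n in sequentially. q \<le> l ((p n)(j := q))"
      using stdf_bounds(1)[of l "(p n)(j := q)" j for n, OF l nn] by simp
    show "\<forall>\<^sub>F n in sequentially. l ((p n)(j := q)) \<le> (\<Sum>i\<in>UNIV. ((p n)(j := q)) i)"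
      by (intro always_eventually allI stdf_bounds(2) l nn)
    have "(\<lambda>n. ((p n)(j := q)) i) \<longlonglongrightarrow> (if i = j then q else 0)" for i
      using p_lim by simp
    from tendsto_sum[of UNIV "\<lambda>i n. ((p n)(j := q)) i", OF this]
    show "(\<lambda>n. \<Sum>i\<in>UNIV. ((p n)(j := q)) i) \<longlonglongrightarrow> q" by simp
  qed
  then have lim: "(\<lambda>n. joint_cdf H ((b n)(j := x))) \<longlonglongrightarrow> c - q"
    unfolding cdf_c by (intro tendsto_intros)

  define A where "A = {y :: 'd \<Rightarrow> ereal. y j \<le> ereal x}"
  define B where "B u = {y :: 'd \<Rightarrow> ereal. \<forall>i. y i \<le> ereal (u i)}" for u
  have A [measurable]: "A \<in> events"
    unfolding A_def by measurable
  have B [measurable]: "B u \<in> events" for u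
    unfolding B_def by measurable
  have marg: "marginal_cdf H j x = prob A"
    unfolding marginal_cdf_def by (subst measure_distr) (auto simp: A_def space vimage_def)
  have lower: "joint_cdf H ((b n)(j := x)) \<le> prob A" for n
    unfolding joint_cdf_def B_def[symmetric]
    by (rule finite_measure_mono[OF _ A]) (auto simp: A_def B_def split: if_splits dest: spec[of _ j])
  \<comment> \<open>A point of \<open>A\<close> outside the box with corner
    \<open>(b n)(j := x)\<close> exceeds \<open>b n\<close> in some coordinate other than
    \<open>j\<close>, hence lies outside \<open>B (b n)\<close>.\<close>
  have upper: "prob A \<le> joint_cdf H ((b n)(j := x)) + (1 - joint_cdf H (b n))" for n
  proof -
    have "A \<subseteq> B ((b n)(j := x)) \<union> (space H - B (b n))"
      by (auto simp: A_def B_def space)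
    then have "prob A \<le> prob (B ((b n)(j := x)) \<union> (space H - B (b n)))"
      by (intro finite_measure_mono) auto
    also have "\<dots> \<le> prob (B ((b n)(j := x))) + prob (space H - B (b n))"
      by (intro measure_Un_le) auto
    finally show ?thesis
      by (simp add: prob_compl joint_cdf_def B_def)
  qed
  \<comment> \<open>The constant \<open>prob A\<close> is squeezed between two sequences with limit
    \<open>c - q\<close>, hence equals it.\<close>
  have "(\<lambda>_ :: nat. prob A) \<longlonglongrightarrow> c - q"
  proof (rule tendsto_sandwich[OF _ _ lim])
    show "(\<lambda>n. joint_cdf H ((b n)(j := x)) + (1 - joint_cdf H (b n))) \<longlonglongrightarrow> c - q"
      using tendsto_add[OF lim gap] by simp
  qed (use lower upper in auto)
  then have "prob A = c - q" by (simp add: LIMSEQ_const_iff)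
  then show ?thesis by (simp add: marg c_def q_def)
qed

lemma GP_marginal_nonneg:
  assumes "is_GP \<sigma> \<gamma> \<pi> l H" "0 \<le> z"
  shows "l (\<pi>(j := \<pi> j * exp (- min z 0))) = 1"
  using assms by (simp add: is_GP_def min_absorb2)

text \<open>The margin at 0 equals \<open>l \<pi> - \<pi> j = 1 - \<pi> j\<close>, so
  \<open>H\<close> determines \<open>\<pi>\<close> whatever parameters represent it.\<close>

lemma GP_pi_unique:
  assumes "is_GP \<sigma> \<gamma> \<pi> l H" "is_GP \<sigma> \<gamma> \<pi>' l' H"
  shows "\<pi> j = \<pi>' j"
proof -
  have dom: "0 < \<sigma> j + \<gamma> j * 0" and "l \<pi> = 1" "l' \<pi>' = 1"
    using assms by (simp_all add: is_GP_def)
  then show ?thesis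
    using GP_marginal[OF assms(1) dom refl] GP_marginal[OF assms(2) dom refl]
    by simp
qed

section \<open>Margins under the S, T and U representations\<close>

lemma AE_distr_less_PInf:
  fixes X :: "'m \<Rightarrow> 'd::finite \<Rightarrow> ereal"
  assumes [measurable]: "X \<in> borel_measurable M"
    and "AE s in distr M borel X. \<forall>j. s j < \<infinity>"
  shows "AE \<omega> in M. \<forall>j. X \<omega> j < \<infinity>"
  using assms(2) by (subst (asm) AE_distr_iff) auto

text \<open>Stated for any vector \<open>X\<close> with the required law, so that it serves both for
  \<open>S\<close> itself and for \<open>T\<close> minus its maximum.\<close>

lemma GP_S_marginal:
  fixes X :: "'m \<Rightarrow> 'd::finite \<Rightarrow> ereal"
  assumes X [measurable]: "X \<in> borel_measurable M" and GP: "is_GP_S \<sigma> \<gamma> (distr M borel X) H"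
    and x: "0 < \<sigma> j + \<gamma> j * x" and z: "z = gp_log (\<gamma> j) (x / \<sigma> j)"
  shows "marginal_cdf H j x =
      (\<integral>\<omega>. max_exp_shift (X \<omega>) j (min z 0) \<partial>M) - exp (- z) * (\<integral>\<omega>. eexp (X \<omega> j) \<partial>M)"
    and "0 \<le> z \<Longrightarrow> (\<integral>\<omega>. max_exp_shift (X \<omega>) j (min z 0) \<partial>M) = 1"
proof -
  have [measurable]: "(\<lambda>\<omega>. X \<omega> i) \<in> borel_measurable M" for i
    by (rule measurable_product_then_coordinatewise[OF X])
  define \<pi> where "\<pi> i = (\<integral>s. eexp (s i) \<partial>distr M borel X)" for i
  define l where "l y = (\<integral>s. Max (range (\<lambda>i. y i * eexp (s i) / \<pi> i)) \<partial>distr M borel X)" for y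
  have H: "is_GP \<sigma> \<gamma> \<pi> l H"
    using GP unfolding is_GP_S_def \<pi>_def[abs_def] l_def[abs_def] by simp
  then have \<pi>: "\<pi> i \<noteq> 0" for i by (auto simp: is_GP_def dest: spec[of _ i])
  have \<pi>_eq: "\<pi> i = (\<integral>\<omega>. eexp (X \<omega> i) \<partial>M)" for i
    unfolding \<pi>_def by (rule integral_distr) measurable
  have "AE s in distr M borel X. \<forall>j. s j \<le> 0"
    using GP by (simp add: is_GP_S_def is_spectral_law_def)
  then have "AE s in distr M borel X. \<forall>j. s j < \<infinity>"
  proof eventually_elim
    case (elim s)
    have "0 < (\<infinity> :: ereal)" by simp
    then show ?case using elim le_less_trans by blast
  qed
  then have fin: "AE \<omega> in M. \<forall>j. X \<omega> j < \<infinity>"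
    by (rule AE_distr_less_PInf[OF X])
  \<comment> \<open>The weight \<open>\<pi> i\<close> in the argument cancels the normalization
    \<open>\<pi> i\<close> inside \<open>l\<close>; only the factor \<open>exp (- w)\<close> at
    \<open>j\<close> survives.\<close>
  have l_eq: "l (\<pi>(j := \<pi> j * exp (- w))) = (\<integral>\<omega>. max_exp_shift (X \<omega>) j w \<partial>M)" for w
  proof -
    have "l (\<pi>(j := \<pi> j * exp (- w))) =
        (\<integral>\<omega>. Max (range (\<lambda>i. (\<pi>(j := \<pi> j * exp (- w))) i * eexp (X \<omega> i) / \<pi> i)) \<partial>M)"
      unfolding l_def by (rule integral_distr) measurable
    also have "\<dots> = (\<integral>\<omega>. max_exp_shift (X \<omega>) j w \<partial>M)"
    proof (rule integral_cong_AE)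
      show "AE \<omega> in M. Max (range (\<lambda>i. (\<pi>(j := \<pi> j * exp (- w))) i * eexp (X \<omega> i) / \<pi> i))
          = max_exp_shift (X \<omega>) j w"
        using fin
      proof eventually_elim
        case (elim \<omega>)
        then show ?case using \<pi>
          by (auto simp: max_exp_shift_eq intro!: arg_cong[where f = Max] image_cong)
      qed
    qed measurable
    finally show ?thesis .
  qed
  show "marginal_cdf H j x =
      (\<integral>\<omega>. max_exp_shift (X \<omega>) j (min z 0) \<partial>M) - exp (- z) * (\<integral>\<omega>. eexp (X \<omega> j) \<partial>M)"
    using GP_marginal[OF H x z] by (simp add: l_eq \<pi>_eq[of j, symmetric])
  show "(\<integral>\<omega>. max_exp_shift (X \<omega>) j (min z 0) \<partial>M) = 1" if "0 \<le> z"
    using GP_marginal_nonneg[OF H that, of j] by (simp only: l_eq)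
qed

text \<open>Both \<open>\<pi>\<close> and the exponential moments of \<open>X\<close> are parameters
  of the same \<open>H\<close>, so uniqueness identifies them.\<close>

lemma GP_S_pi:
  fixes X :: "'m \<Rightarrow> 'd::finite \<Rightarrow> ereal"
  assumes [measurable]: "X \<in> borel_measurable M" and "is_GP_S \<sigma> \<gamma> (distr M borel X) H"
    and "is_GP \<sigma> \<gamma> \<pi> l H"
  shows "\<pi> j = (\<integral>\<omega>. eexp (X \<omega> j) \<partial>M)"
proof -
  have "\<pi> j = (\<integral>s. eexp (s j) \<partial>distr M borel X)"
    using assms by (auto simp: is_GP_S_def intro: GP_pi_unique)
  also have "\<dots> = (\<integral>\<omega>. eexp (X \<omega> j) \<partial>M)"
    by (rule integral_distr) measurable
  finally show ?thesis .
qed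

lemma borel_measurable_minus_Max [measurable]:
  "(\<lambda>t i. t i - Max (range t)) \<in> borel_measurable (borel :: ('d::finite \<Rightarrow> ereal) measure)"
  by (rule measurable_coordinatewise_then_product) measurable

text \<open>Composing the two push-forwards reduces the T case to the S case over the original
  measure.\<close>

lemma GP_T_imp_GP_S:
  fixes X :: "'m \<Rightarrow> 'd::finite \<Rightarrow> ereal"
  assumes [measurable]: "X \<in> borel_measurable M" and "is_GP_T \<sigma> \<gamma> (distr M borel X) H"
  shows "is_GP_S \<sigma> \<gamma> (distr M borel (\<lambda>\<omega> i. X \<omega> i - Max (range (X \<omega>)))) H"
proof -
  have "distr (distr M borel X) borel (\<lambda>t i. t i - Max (range t))
      = distr M borel (\<lambda>\<omega> i. X \<omega> i - Max (range (X \<omega>)))"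
    by (subst distr_distr) (auto simp: comp_def)
  then show ?thesis using assms(2) by (simp add: is_GP_T_def)
qed

text \<open>Here \<open>l\<close> is normalized by \<open>e i\<close> while
  \<open>\<pi> i = e i / m\<close>, so cancellation leaves the common factor \<open>1 / m\<close>,
  which comes out of the maximum and becomes the denominator.\<close>

lemma GP_U_marginal:
  fixes X :: "'m \<Rightarrow> 'd::finite \<Rightarrow> ereal"
  assumes X [measurable]: "X \<in> borel_measurable M" and GP: "is_GP_U \<sigma> \<gamma> (distr M borel X) H"
    and x: "0 < \<sigma> j + \<gamma> j * x" and z: "z = gp_log (\<gamma> j) (x / \<sigma> j)"
  shows "marginal_cdf H j x =
      ((\<integral>\<omega>. max_exp_shift (X \<omega>) j (min z 0) \<partial>M) - exp (- z) * (\<integral>\<omega>. eexp (X \<omega> j) \<partial>M))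
      / (\<integral>\<omega>. eexp (Max (range (X \<omega>))) \<partial>M)"
proof -
  have [measurable]: "(\<lambda>\<omega>. X \<omega> i) \<in> borel_measurable M" for i
    by (rule measurable_product_then_coordinatewise[OF X])
  define e where "e i = (\<integral>u. eexp (u i) \<partial>distr M borel X)" for i
  define m where "m = (\<integral>u. eexp (Max (range u)) \<partial>distr M borel X)"
  define \<pi> where "\<pi> i = e i / m" for i
  define l where "l y = (\<integral>u. Max (range (\<lambda>i. y i * eexp (u i) / e i)) \<partial>distr M borel X)" for y
  have H: "is_GP \<sigma> \<gamma> \<pi> l H"
    using GP unfolding is_GP_U_def \<pi>_def[abs_def] l_def[abs_def] e_def[abs_def] m_def by simp
  have e: "0 < e i" for i
    using GP by (auto simp: is_GP_U_def e_def)
  \<comment> \<open>Positivity of \<open>m\<close> follows from that of the parameter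
    \<open>\<pi> j = e j / m\<close>; this also rules out the default value 0 of a divergent
    integral.\<close>
  have "0 < e j / m" using H unfolding is_GP_def by (simp add: \<pi>_def)
  then have m: "0 < m" using e[of j] by (simp add: zero_less_divide_iff)
  have e_eq: "e j = (\<integral>\<omega>. eexp (X \<omega> j) \<partial>M)"
    unfolding e_def by (rule integral_distr) measurable
  have m_eq: "m = (\<integral>\<omega>. eexp (Max (range (X \<omega>))) \<partial>M)"
    unfolding m_def by (rule integral_distr) measurable
  have fin: "AE \<omega> in M. \<forall>j. X \<omega> j < \<infinity>"
    using GP by (intro AE_distr_less_PInf[OF X]) (simp add: is_GP_U_def)
  define w where "w = min z 0"
  have "l (\<pi>(j := \<pi> j * exp (- w))) =
      (\<integral>\<omega>. Max (range (\<lambda>i. (\<pi>(j := \<pi> j * exp (- w))) i * eexp (X \<omega> i) / e i)) \<partial>M)"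
    unfolding l_def by (rule integral_distr) measurable
  also have "\<dots> = (\<integral>\<omega>. 1 / m * max_exp_shift (X \<omega>) j w \<partial>M)"
  proof (rule integral_cong_AE)
    show "AE \<omega> in M. Max (range (\<lambda>i. (\<pi>(j := \<pi> j * exp (- w))) i * eexp (X \<omega> i) / e i))
        = 1 / m * max_exp_shift (X \<omega>) j w"
      using fin
    proof eventually_elim
      case (elim \<omega>)
      have "(\<pi>(j := \<pi> j * exp (- w))) i * eexp (X \<omega> i) / e i
          = 1 / m * ((if i = j then exp (- w) else 1) * eexp (X \<omega> i))" for i
        using e[of i] by (auto simp: \<pi>_def field_simps)
      then show ?case using elim m
        by (simp only: max_exp_shift_eq Max_range_mult_left[of "1 / m", symmetric]
            zero_le_divide_1_iff less_imp_le)
    qed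
  qed measurable
  finally have "l (\<pi>(j := \<pi> j * exp (- w))) = (\<integral>\<omega>. max_exp_shift (X \<omega>) j w \<partial>M) / m" by simp
  then show ?thesis
    using GP_marginal[OF H x z]
    by (simp add: w_def \<pi>_def e_eq m_eq[symmetric] diff_divide_distrib mult.commute)
qed

section \<open>Assembly of the marginal formulas\<close>

theorem proposition6p1:
  fixes \<sigma> \<gamma> \<pi> :: "'d::finite \<Rightarrow> real"
    and l :: "('d \<Rightarrow> real) \<Rightarrow> real"
    and H :: "('d \<Rightarrow> ereal) measure"
    and M :: "'m measure" and S :: "'m \<Rightarrow> 'd \<Rightarrow> ereal"
    and N :: "'n measure" and T :: "'n \<Rightarrow> 'd \<Rightarrow> ereal"
    and P :: "'p measure" and U :: "'p \<Rightarrow> 'd \<Rightarrow> ereal"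
    and j :: 'd
  assumes "prob_space M" and "S \<in> borel_measurable M"
    and "prob_space N" and "T \<in> borel_measurable N"
    and "prob_space P" and "U \<in> borel_measurable P"
    and "is_GP \<sigma> \<gamma> \<pi> l H"
    and "is_GP_S \<sigma> \<gamma> (distr M borel S) H"
  shows
    "(\<sigma> j = 1 \<and> \<gamma> j = 0 \<longrightarrow>
       (\<forall>z::real.
          marginal_cdf H j z = l (\<pi>(j := \<pi> j * exp (- min z 0))) - \<pi> j * exp (- z) \<and>
          marginal_cdf H j z =
            (\<integral>\<omega>. max_exp_shift (S \<omega>) j (min z 0) \<partial>M) - exp (- z) * (\<integral>\<omega>. eexp (S \<omega> j) \<partial>M) \<and>
          (0 \<le> z \<longrightarrow>
            l (\<pi>(j := \<pi> j * exp (- min z 0))) - \<pi> j * exp (- z) = 1 - \<pi> j * exp (- z) \<and>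
            (\<integral>\<omega>. max_exp_shift (S \<omega>) j (min z 0) \<partial>M) - exp (- z) * (\<integral>\<omega>. eexp (S \<omega> j) \<partial>M)
              = 1 - exp (- z) * (\<integral>\<omega>. eexp (S \<omega> j) \<partial>M) \<and>
            1 - \<pi> j * exp (- z) = 1 - exp (- z) * (\<integral>\<omega>. eexp (S \<omega> j) \<partial>M)) \<and>
          (is_GP_T \<sigma> \<gamma> (distr N borel T) H \<longrightarrow>
            marginal_cdf H j z =
              (\<integral>\<omega>. max_exp_shift (\<lambda>i. T \<omega> i - Max (range (T \<omega>))) j (min z 0) \<partial>N)
              - exp (- z) * (\<integral>\<omega>. eexp (T \<omega> j - Max (range (T \<omega>))) \<partial>N) \<and>
            (0 \<le> z \<longrightarrow>
              (\<integral>\<omega>. max_exp_shift (\<lambda>i. T \<omega> i - Max (range (T \<omega>))) j (min z 0) \<partial>N)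
              - exp (- z) * (\<integral>\<omega>. eexp (T \<omega> j - Max (range (T \<omega>))) \<partial>N)
                = 1 - exp (- z) * (\<integral>\<omega>. eexp (T \<omega> j - Max (range (T \<omega>))) \<partial>N))) \<and>
          (is_GP_U \<sigma> \<gamma> (distr P borel U) H \<longrightarrow>
            marginal_cdf H j z =
              ((\<integral>\<omega>. max_exp_shift (U \<omega>) j (min z 0) \<partial>P) - exp (- z) * (\<integral>\<omega>. eexp (U \<omega> j) \<partial>P))
              / (\<integral>\<omega>. eexp (Max (range (U \<omega>))) \<partial>P))))
     \<and>
     (\<forall>x::real. 0 < \<sigma> j + \<gamma> j * x \<longrightarrow>
       (\<forall>z. z = gp_log (\<gamma> j) (x / \<sigma> j) \<longrightarrow>
          exp (- z) = gp_pow (\<gamma> j) (x / \<sigma> j) \<and>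
          marginal_cdf H j x = l (\<pi>(j := \<pi> j * exp (- min z 0))) - \<pi> j * exp (- z) \<and>
          marginal_cdf H j x =
            (\<integral>\<omega>. max_exp_shift (S \<omega>) j (min z 0) \<partial>M) - exp (- z) * (\<integral>\<omega>. eexp (S \<omega> j) \<partial>M) \<and>
          (0 \<le> x \<longrightarrow>
            l (\<pi>(j := \<pi> j * exp (- min z 0))) - \<pi> j * exp (- z) = 1 - \<pi> j * exp (- z) \<and>
            (\<integral>\<omega>. max_exp_shift (S \<omega>) j (min z 0) \<partial>M) - exp (- z) * (\<integral>\<omega>. eexp (S \<omega> j) \<partial>M)
              = 1 - exp (- z) * (\<integral>\<omega>. eexp (S \<omega> j) \<partial>M) \<and>
            1 - \<pi> j * exp (- z) = 1 - exp (- z) * (\<integral>\<omega>. eexp (S \<omega> j) \<partial>M)) \<and>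
          (is_GP_T \<sigma> \<gamma> (distr N borel T) H \<longrightarrow>
            marginal_cdf H j x =
              (\<integral>\<omega>. max_exp_shift (\<lambda>i. T \<omega> i - Max (range (T \<omega>))) j (min z 0) \<partial>N)
              - exp (- z) * (\<integral>\<omega>. eexp (T \<omega> j - Max (range (T \<omega>))) \<partial>N) \<and>
            (0 \<le> x \<longrightarrow>
              (\<integral>\<omega>. max_exp_shift (\<lambda>i. T \<omega> i - Max (range (T \<omega>))) j (min z 0) \<partial>N)
              - exp (- z) * (\<integral>\<omega>. eexp (T \<omega> j - Max (range (T \<omega>))) \<partial>N)
                = 1 - exp (- z) * (\<integral>\<omega>. eexp (T \<omega> j - Max (range (T \<omega>))) \<partial>N))) \<and>
          (is_GP_U \<sigma> \<gamma> (distr P borel U) H \<longrightarrow>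
            marginal_cdf H j x =
              ((\<integral>\<omega>. max_exp_shift (U \<omega>) j (min z 0) \<partial>P) - exp (- z) * (\<integral>\<omega>. eexp (U \<omega> j) \<partial>P))
              / (\<integral>\<omega>. eexp (Max (range (U \<omega>))) \<partial>P))))"
proof -
  note S = \<open>S \<in> borel_measurable M\<close> and U = \<open>U \<in> borel_measurable P\<close>
    and GP = \<open>is_GP \<sigma> \<gamma> \<pi> l H\<close> and GPS = \<open>is_GP_S \<sigma> \<gamma> (distr M borel S) H\<close>
  have [measurable]: "T \<in> borel_measurable N" by fact
  have T: "(\<lambda>\<omega> i. T \<omega> i - Max (range (T \<omega>))) \<in> borel_measurable N"
    by (rule measurable_compose[OF _ borel_measurable_minus_Max]) measurable
  note GPT = GP_T_imp_GP_S[of T N \<sigma> \<gamma> H, OF \<open>T \<in> borel_measurable N\<close>]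
  have \<sigma>: "0 < \<sigma> j" using GP by (simp add: is_GP_def)
  note \<pi> = GP_S_pi[OF S GPS GP, of j]
  show ?thesis (is "(_ \<longrightarrow> ?standard) \<and> ?general")
  proof
    \<comment> \<open>The general margin comes first; the standard one is then the instance
      \<open>\<sigma> j = 1\<close>, \<open>\<gamma> j = 0\<close>.\<close>
    show general: ?general
    proof (intro allI impI, goal_cases)
      case (1 x z)
      then have pos: "0 < 1 + \<gamma> j * (x / \<sigma> j)"
        using \<sigma> by (simp add: field_simps)
      have z_nonneg: "0 \<le> z" if "0 \<le> x"
        using gp_log_nonneg[OF _ pos] that \<sigma> 1 by simp
      \<comment> \<open>The fact \<open>1\<close> supplies both the domain condition and the
        equation for \<open>z\<close>; \<open>Tm\<close> and \<open>Um\<close> keep the respective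
        representation of \<open>H\<close> as an open premise.\<close>
      note lm = GP_marginal[OF GP 1] and l1 = GP_marginal_nonneg[OF GP, of z j]
        and Sm = GP_S_marginal[OF S GPS 1] and Tm = GP_S_marginal[of "\<lambda>\<omega> i. T \<omega> i - Max (range (T \<omega>))", OF T GPT 1]
        and Um = GP_U_marginal[of U P \<sigma> \<gamma> H, OF U _ 1]
      show ?case
      proof (intro conjI impI, goal_cases)
        case 1 show ?case using exp_minus_gp_log[OF pos] \<open>z = _\<close> by simp
      next
        case 2 show ?case by (rule lm)
      next
        case 3 show ?case by (rule Sm(1))
      next
        case 4 then show ?case using l1[OF z_nonneg] by simp
      next
        case 5 then show ?case using Sm(2)[OF z_nonneg] by simp
      next
        \<comment> \<open>The two simplified forms agree because \<open>\<pi> j\<close> is the mean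
          of \<open>eexp (S \<omega> j)\<close>.\<close>
        case 6 show ?case using \<pi> by simp
      next
        case 7 then show ?case by (rule Tm(1))
      next
        case 8 then show ?case using Tm(2)[OF _ z_nonneg] by simp
      next
        case 9 then show ?case by (rule Um)
      qed
    qed
    show "\<sigma> j = 1 \<and> \<gamma> j = 0 \<longrightarrow> ?standard"
    proof (intro impI allI, goal_cases)
      case (1 z)
      \<comment> \<open>For these parameters the domain is the whole line and the transform is the
        identity, so \<open>z\<close> plays the role of \<open>x\<close>.\<close>
      then have "0 < \<sigma> j + \<gamma> j * z" "z = gp_log (\<gamma> j) (z / \<sigma> j)"
        by (simp_all add: gp_log_def)
      from general[rule_format, OF this] show ?case by blast
    qed
  qed
qed

end
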